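(* Let $R$ be a principal ideal domain. If $f=\sum_{i=0}^\infty a_i z^i\in R[[z]]$ is such that $a_0$ is a nonzero nonunit in $R$, then $$\omega(a_0)\leq \Omega_f\leq \Omega(a_0).$$ In particular, if $a_0$ is an associate of a prime in $R$, then $f$ is irreducible in $R[[z]]$.
   Context: $R[[z]]$ denotes the ring of formal power series in $z$ over $R$; when $R$ is a principal ideal domain, $R[[z]]$ is a unique factorization domain. For a nonzero nonunit $n$ in a unique factorization domain $R$, $\omega(n)$ denotes the number of pairwise nonassociate prime divisors of $n$, and $\Omega(n)$ denotes the number of prime divisors of $n$ (up to associates) counted with multiplicity. For $f\in R[[z]]$, $\Omega_f$ denotes the number of irreducible factors of $f$ in $R[[z]]$ counted with multiplicity. *)

theory Defs
  imports
    "HOL-Computational_Algebra.Formal_Power_Series"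
begin

definition (in comm_ring_1) ring_ideal :: "'a set \<Rightarrow> bool" where
  "ring_ideal I \<longleftrightarrow>
     0 \<in> I \<and> (\<forall>x\<in>I. \<forall>y\<in>I. x + y \<in> I) \<and> (\<forall>r. \<forall>x\<in>I. r * x \<in> I)"

(* The library's normalization and factorization classes fix additional operations (division,
   unit factor, normal form, gcd), so a bare principal ideal domain is introduced here. *)
class pid = idom +
  assumes ideal_principal: "ring_ideal I \<Longrightarrow> \<exists>a. I = {r * a | r. True}"

definition associates :: "'a::comm_semiring_1 \<Rightarrow> 'a \<Rightarrow> bool" where
  "associates x y \<longleftrightarrow> x dvd y \<and> y dvd x"

(* The elements counted are the association classes of the prime divisors of n. *)
definition omega :: "'a::idom \<Rightarrow> nat" where
  "omega n = card ({p. prime_elem p \<and> p dvd n} // {(p, q). associates p q})"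

(* The size of any multiset of primes whose product is n up to a unit; it does not depend on the
   multiset by Omega_eqI. Meaningful when n has a prime factorization. *)
definition Omega :: "'a::idom \<Rightarrow> nat" where
  "Omega n = (THE k. \<exists>A. (\<forall>p\<in>#A. prime_elem p) \<and> associates (prod_mset A) n \<and> size A = k)"

(* The same with irreducible factors. The size is independent of the factorization as soon as one
   prime factorization exists (irreducible_count_eqI), as is the case in a unique factorization
   domain. *)
definition irreducible_count :: "'a::idom \<Rightarrow> nat" where
  "irreducible_count f =
     (THE k. \<exists>A. (\<forall>p\<in>#A. irreducible p) \<and> associates (prod_mset A) f \<and> size A = k)"

lemma associates_sym: "associates x y \<Longrightarrow> associates y x"
  by (simp add: associates_def)

lemma associates_trans: "associates x y \<Longrightarrow> associates y z \<Longrightarrow> associates x z"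
  unfolding associates_def by (blast intro: dvd_trans)

lemma prime_elem_imp_irreducible_idom:
  fixes p :: "'a::idom"
  assumes p: "prime_elem p"
  shows "irreducible p"
proof (rule irreducibleI)
  show "p \<noteq> 0" "\<not> p dvd 1" using p by (auto simp: prime_elem_def)
next
  fix a b assume ab: "p = a * b"
  have nz: "p \<noteq> 0" using p by (auto simp: prime_elem_def)
  have "p dvd a \<or> p dvd b" using p ab unfolding prime_elem_def by (metis dvd_refl)
  then show "a dvd 1 \<or> b dvd 1"
  proof
    assume "p dvd a"
    then obtain c where c: "a = p * c" by (rule dvdE)
    have "p * 1 = p * (c * b)" using ab c by (metis mult.assoc mult_1_right)
    then have "1 = c * b" by (simp only: mult_cancel_left nz) simp
    then show ?thesis by (metis dvd_triv_right)
  next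
    assume "p dvd b"
    then obtain c where c: "b = p * c" by (rule dvdE)
    have "p * 1 = p * (a * c)" using ab c by (metis mult.left_commute mult_1_right)
    then have "1 = a * c" by (simp only: mult_cancel_left nz) simp
    then show ?thesis by (metis dvd_triv_left)
  qed
qed

lemma prime_elem_dvd_prod_mset_idom:
  fixes p :: "'a::idom"
  assumes "prime_elem p" "p dvd prod_mset B"
  shows "\<exists>b\<in>#B. p dvd b"
  using assms(2)
proof (induction B)
  case empty
  then show ?case using assms(1) by (simp add: prime_elem_def)
next
  case (add b B)
  then show ?case using assms(1) by (auto simp: prime_elem_def)
qed

lemma factorization_size_unique:
  fixes A B :: "'a::idom multiset"
  assumes "\<forall>p\<in>#A. prime_elem p" "\<forall>p\<in>#B. irreducible p"
    and "associates (prod_mset A) (prod_mset B)"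
  shows "size A = size B"
  using assms
proof (induction A arbitrary: B)
  case empty
  have "B = {#}"
  proof (rule ccontr)
    assume "B \<noteq> {#}"
    then obtain b B' where B: "B = add_mset b B'" by (meson multiset_cases)
    then have "b dvd 1" using empty.prems(3) by (auto simp: associates_def dest: dvd_mult_left)
    then show False using empty.prems(2) B by (auto simp: irreducible_def)
  qed
  then show ?case by simp
next
  case (add p A)
  have p: "prime_elem p" and p0: "p \<noteq> 0" and pu: "\<not> p dvd 1"
    using add.prems(1) by (auto simp: prime_elem_def)
  have "p dvd prod_mset B"
    using add.prems(3) by (auto simp: associates_def dest: dvd_mult_left)
  then obtain b where b: "b \<in># B" "p dvd b"
    using prime_elem_dvd_prod_mset_idom[OF p] by blast
  then obtain u B' where u: "b = p * u" and B: "B = add_mset b B'"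
    by (meson dvdE mset_add)
  have "irreducible b" using b add.prems(2) by blast
  then have uu: "u dvd 1" using u pu unfolding irreducible_def by blast
  have "associates (p * prod_mset A) (p * (u * prod_mset B'))"
    using add.prems(3) B u by (simp add: mult.assoc)
  then have "associates (prod_mset A) (u * prod_mset B')"
    using p0 by (simp add: associates_def)
  moreover have "associates (u * prod_mset B') (prod_mset B')"
    using mult_dvd_mono[OF uu, of "prod_mset B'" "prod_mset B'"] by (simp add: associates_def)
  ultimately have "associates (prod_mset A) (prod_mset B')"
    by (rule associates_trans)
  then have "size A = size B'" using add B by auto
  then show ?case using B by simp
qed

lemma Omega_eqI:
  assumes "\<forall>p\<in>#A. prime_elem p" "associates (prod_mset A) n"
  shows "Omega n = size A"
  unfolding Omega_def
proof (rule the_equality)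
  show "\<exists>B. (\<forall>p\<in>#B. prime_elem p) \<and> associates (prod_mset B) n \<and> size B = size A"
    using assms by blast
next
  fix k assume "\<exists>B. (\<forall>p\<in>#B. prime_elem p) \<and> associates (prod_mset B) n \<and> size B = k"
  then obtain B where B: "\<forall>p\<in>#B. prime_elem p" "associates (prod_mset B) n" "size B = k"
    by blast
  have "associates (prod_mset A) (prod_mset B)"
    using assms(2) B(2) by (blast intro: associates_trans associates_sym)
  moreover have "\<forall>p\<in>#B. irreducible p"
    using B(1) prime_elem_imp_irreducible_idom by blast
  ultimately show "k = size A"
    using factorization_size_unique[OF assms(1)] B(3) by metis
qed

lemma irreducible_count_eqI:
  assumes "\<forall>p\<in>#A. prime_elem p" "associates (prod_mset A) f"
  shows "irreducible_count f = size A"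
  unfolding irreducible_count_def
proof (rule the_equality)
  show "\<exists>B. (\<forall>p\<in>#B. irreducible p) \<and> associates (prod_mset B) f \<and> size B = size A"
    using assms prime_elem_imp_irreducible_idom by blast
next
  fix k assume "\<exists>B. (\<forall>p\<in>#B. irreducible p) \<and> associates (prod_mset B) f \<and> size B = k"
  then obtain B where B: "\<forall>p\<in>#B. irreducible p" "associates (prod_mset B) f" "size B = k"
    by blast
  have "associates (prod_mset A) (prod_mset B)"
    using assms(2) B(2) by (blast intro: associates_trans associates_sym)
  then show "k = size A"
    using factorization_size_unique[OF assms(1) B(1)] B(3) by metis
qed

end

theory Submission
  imports Defs
begin

text \<open>
  Write \<open>X\<close> for the variable and \<open>f\<^sub>0\<close> for the constant coefficient of \<open>f\<close>. A power series is a unit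
  exactly when its constant coefficient is one, so passing to constant coefficients turns a
  factorization of \<open>f\<close> into nonunits into a factorization of \<open>f\<^sub>0\<close> into nonunits. Both bounds come
  from this map once it is known that \<open>f\<close> has a prime factorization at all.

  \<^emph>\<open>Prime factorization.\<close> Proper divisibility in \<open>R\<close> is well-founded by the ascending chain
  condition, and this lifts along \<open>f \<mapsto> f\<^sub>0\<close>, so a series with nonzero constant coefficient is a product
  of irreducibles. An irreducible \<open>g\<close> with \<open>g\<^sub>0 \<noteq> 0\<close> is prime
  (\<open>irreducible_fps_imp_prime_elem\<close>) for the reason that works in a principal ideal domain, applied
  to the right ideals: an ideal \<open>J\<close> of \<open>R[[X]]\<close> such that \<open>X x \<in> J\<close> implies \<open>x \<in> J\<close> is principal
  (\<open>X_saturated_ideal_principal\<close>), and the ideal \<open>(g, a)\<close> can be replaced by its saturation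
  \<open>{x. \<exists>k. X\<^sup>k x \<in> (g, a)}\<close> because \<open>X\<close> can be cancelled modulo \<open>g\<close>.

  \<^emph>\<open>Upper bound.\<close> Each of the prime factors of \<open>f\<close> contributes at least one prime factor to \<open>f\<^sub>0\<close>.

  \<^emph>\<open>Lower bound.\<close> A factorization \<open>f\<^sub>0 = b c\<close> with \<open>b\<close> and \<open>c\<close> comaximal lifts to \<open>f\<close>, as in Hensel's
  lemma (\<open>lift_comaximal_factorization\<close>). Hence the constant coefficient of an irreducible series
  has, up to associates, a single prime divisor. Every prime divisor of \<open>f\<^sub>0\<close> divides the constant
  coefficient of some prime factor of \<open>f\<close>, and so there are at least as many factors as classes of
  primes.
\<close>

section \<open>Divisibility in integral domains\<close>

lemma associates_mult:
  "associates a b \<Longrightarrow> associates c d \<Longrightarrow> associates (a * c) (b * d)"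
  by (simp add: associates_def mult_dvd_mono)

lemma associates_refl: "associates a a"
  by (simp add: associates_def)

lemma associates_mult_unit: "u dvd 1 \<Longrightarrow> associates (a * u) a"
  using mult_dvd_mono[of a a u 1] by (simp add: associates_def)

lemma dvd_mult_self_imp_unit:
  fixes a :: "'a::idom"
  assumes "a \<noteq> 0" "a * b dvd a"
  shows "b dvd 1"
proof -
  have "a * b dvd a * 1" using assms by simp
  then show ?thesis using assms(1) by (metis dvd_mult_cancel_left)
qed

lemma associates_primeI:
  fixes p q :: "'a::idom"
  assumes "prime_elem p" "prime_elem q" "p dvd q"
  shows "associates p q"
proof -
  obtain r where r: "q = p * r" using assms(3) by (rule dvdE)
  have "p dvd 1 \<or> r dvd 1"
    using prime_elem_imp_irreducible_idom[OF assms(2)] r by (rule irreducibleD)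
  then have "r dvd 1" using assms(1) by (auto simp: prime_elem_def)
  then show ?thesis unfolding r by (intro associates_sym[OF associates_mult_unit])
qed

lemma prime_elem_associates:
  fixes p q :: "'a::idom"
  assumes "prime_elem p" "associates p q"
  shows "prime_elem q"
  using assms unfolding prime_elem_def associates_def
  by (metis dvd_0_left dvd_trans)

text \<open>
  The relation and the set are left open so that the same descent serves \<open>R\<close> and \<open>R[[X]]\<close>: in the
  latter, well-foundedness is inherited from the constant coefficients, and only series whose constant
  coefficient is nonzero can be compared in this way.
\<close>

lemma irreducible_factorization_exists:
  fixes x :: "'a::idom"
  assumes "wf r" "x \<in> S" "0 \<notin> S"
    and step: "\<And>a b. a * b \<in> S \<Longrightarrow> \<not> b dvd 1 \<Longrightarrow> a \<in> S \<and> (a, a * b) \<in> r"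
  shows "\<exists>A. (\<forall>p\<in>#A. irreducible p) \<and> associates (prod_mset A) x"
  using assms(1,2)
proof (induction x rule: wf_induct_rule)
  case (less x)
  consider "x dvd 1" | "irreducible x" | a b where "x = a * b" "\<not> a dvd 1" "\<not> b dvd 1"
    using less.prems assms(3) unfolding irreducible_def by metis
  then show ?case
  proof cases
    case 1
    then have "associates (prod_mset {#}) x" by (simp add: associates_def)
    then show ?thesis by (metis empty_iff set_mset_empty)
  next
    case 2
    then have "\<forall>p\<in>#{#x#}. irreducible p" "associates (prod_mset {#x#}) x"
      by (simp_all add: associates_refl)
    then show ?thesis by blast
  next
    case 3
    have "a \<in> S" "(a, x) \<in> r" using step[of a b] less.prems 3 by auto
    then obtain A where A: "\<forall>p\<in>#A. irreducible p" "associates (prod_mset A) a"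
      using less.IH by blast
    have "b \<in> S" "(b, x) \<in> r" using step[of b a] less.prems 3 by (auto simp: mult.commute)
    then obtain B where B: "\<forall>p\<in>#B. irreducible p" "associates (prod_mset B) b"
      using less.IH by blast
    have "associates (prod_mset (A + B)) x"
      using associates_mult[OF A(2) B(2)] 3 by simp
    then show ?thesis using A(1) B(1) by (metis union_iff)
  qed
qed

section \<open>Principal ideal domains\<close>

lemma pid_bezout:
  fixes a b :: "'a::pid"
  obtains d u v where "d dvd a" "d dvd b" "d = u * a + v * b"
proof -
  let ?I = "{u * a + v * b | u v. True}"
  have "ring_ideal ?I"
    unfolding ring_ideal_def
  proof (intro conjI ballI allI)
    show "0 \<in> ?I" by (auto intro!: exI[of _ 0])
  next
    fix x y assume "x \<in> ?I" "y \<in> ?I"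
    then obtain u v u' v' where "x = u * a + v * b" "y = u' * a + v' * b" by blast
    then have "x + y = (u + u') * a + (v + v') * b" by (simp add: algebra_simps)
    then show "x + y \<in> ?I" by blast
  next
    fix r x assume "x \<in> ?I"
    then obtain u v where "x = u * a + v * b" by blast
    then have "r * x = (r * u) * a + (r * v) * b" by (simp add: algebra_simps)
    then show "r * x \<in> ?I" by blast
  qed
  then obtain d where d: "?I = {r * d | r. True}" using ideal_principal by blast
  have "a = 1 * a + 0 * b" "b = 0 * a + 1 * b" by simp_all
  then have "a \<in> ?I" "b \<in> ?I" by blast+
  then have "d dvd a" "d dvd b" unfolding d by auto
  moreover have "d = 1 * d" by simp
  then have "d \<in> ?I" unfolding d by blast
  ultimately show thesis using that by blast
qed

text \<open>
  The ascending chain condition: the union of an increasing chain of principal ideals is generated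
  by an element of one of them, where the chain becomes constant.
\<close>

lemma wf_proper_dvd: "wf {(a, b :: 'a::pid). a dvd b \<and> \<not> b dvd a}"
  unfolding wf_iff_no_infinite_down_chain
proof
  assume "\<exists>s. \<forall>i. (s (Suc i), s i) \<in> {(a, b :: 'a). a dvd b \<and> \<not> b dvd a}"
  then obtain s :: "nat \<Rightarrow> 'a" where s: "s (Suc i) dvd s i" "\<not> s i dvd s (Suc i)" for i
    by blast
  have anti: "s n dvd s m" if "m \<le> n" for m n
    using that s(1) by (induction rule: dec_induct) (auto intro: dvd_trans)
  let ?I = "{x. \<exists>n. s n dvd x}"
  have "ring_ideal ?I"
    unfolding ring_ideal_def
  proof (intro conjI ballI allI)
    show "0 \<in> ?I" by simp
  next
    fix x y assume "x \<in> ?I" "y \<in> ?I"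
    then obtain m n where "s m dvd x" "s n dvd y" by blast
    then have "s (max m n) dvd x" "s (max m n) dvd y"
      using anti[of m "max m n"] anti[of n "max m n"] by (auto intro: dvd_trans)
    then show "x + y \<in> ?I" by (auto intro: dvd_add)
  next
    fix r x assume "x \<in> ?I"
    then show "r * x \<in> ?I" by (auto intro: dvd_mult)
  qed
  then obtain d where d: "?I = {r * d | r. True}" using ideal_principal by blast
  have "d = 1 * d" by simp
  then have "d \<in> ?I" unfolding d by blast
  then obtain n where n: "s n dvd d" by blast
  have "s (Suc n) \<in> ?I" using dvd_refl by blast
  then have "d dvd s (Suc n)" unfolding d by auto
  then show False using n s(2) dvd_trans by blast
qed

lemma irreducible_pid_imp_prime_elem:
  fixes p :: "'a::pid"
  assumes "irreducible p"
  shows "prime_elem p"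
proof (rule prime_elemI)
  show "p \<noteq> 0" "\<not> p dvd 1" using assms by (auto simp: irreducible_def)
next
  fix a b assume ab: "p dvd a * b"
  obtain d u v where d: "d dvd p" "d dvd a" "d = u * p + v * a" by (rule pid_bezout)
  obtain e where e: "p = d * e" using d(1) by (rule dvdE)
  have "d dvd 1 \<or> e dvd 1" using assms e by (rule irreducibleD)
  then show "p dvd a \<or> p dvd b"
  proof
    assume "e dvd 1"
    then have "p dvd d" using associates_mult_unit[of e d] e by (simp add: associates_def)
    then show ?thesis using d(2) dvd_trans by blast
  next
    assume "d dvd 1"
    have "d * b = p * (u * b) + v * (a * b)" unfolding d(3) by (simp add: algebra_simps)
    then have "p dvd b * d" using ab by (simp add: mult.commute)
    then have "p dvd b"
      using associates_mult_unit[OF \<open>d dvd 1\<close>, of b] dvd_trans unfolding associates_def by blast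
    then show ?thesis ..
  qed
qed

lemma pid_prime_factorization_exists:
  fixes x :: "'a::pid"
  assumes "x \<noteq> 0"
  shows "\<exists>A. (\<forall>p\<in>#A. prime_elem p) \<and> associates (prod_mset A) x"
proof -
  have "\<exists>A. (\<forall>p\<in>#A. irreducible p) \<and> associates (prod_mset A) x"
  proof (rule irreducible_factorization_exists[OF wf_proper_dvd])
    show "x \<in> - {0}" using assms by simp
  next
    fix a b :: 'a assume "a * b \<in> - {0}" "\<not> b dvd 1"
    then show "a \<in> - {0} \<and> (a, a * b) \<in> {(a, b). a dvd b \<and> \<not> b dvd a}"
      using dvd_mult_self_imp_unit[of a b] by auto
  qed simp
  then show ?thesis using irreducible_pid_imp_prime_elem by blast
qed

lemma pid_prime_divisor_exists:
  fixes x :: "'a::pid"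
  assumes "x \<noteq> 0" "\<not> x dvd 1"
  shows "\<exists>p. prime_elem p \<and> p dvd x"
proof -
  obtain A where A: "\<forall>p\<in>#A. prime_elem p" "associates (prod_mset A) x"
    using pid_prime_factorization_exists[OF assms(1)] by blast
  have "A \<noteq> {#}" using A(2) assms(2) by (auto simp: associates_def)
  then obtain p where p: "p \<in># A" by blast
  then have "p dvd x"
    using A(2) dvd_prod_mset[OF p] dvd_trans unfolding associates_def by blast
  then show ?thesis using A(1) p by blast
qed

lemma pid_comaximalI:
  fixes b c :: "'a::pid"
  assumes "b \<noteq> 0" and no_common: "\<And>p. prime_elem p \<Longrightarrow> p dvd b \<Longrightarrow> p dvd c \<Longrightarrow> False"
  shows "\<exists>r s. r * b + s * c = 1"
proof -
  obtain d u v where d: "d dvd b" "d dvd c" "d = u * b + v * c" by (rule pid_bezout)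
  have "d \<noteq> 0" using d(1) assms(1) by auto
  then have "d dvd 1"
    using pid_prime_divisor_exists[of d] no_common d(1,2) dvd_trans by blast
  then obtain e where "1 = d * e" by (rule dvdE)
  then have "(e * u) * b + (e * v) * c = 1" unfolding d(3) by (simp add: algebra_simps)
  then show ?thesis by blast
qed

text \<open>
  The factor \<open>b\<close> collects the prime factors of \<open>x\<close> associated to \<open>p\<close>, and \<open>c\<close> the others, \<open>q\<close> among
  them. The two have no prime divisor in common, which makes them comaximal.
\<close>

lemma comaximal_factorization_exists:
  fixes x p q :: "'a::pid"
  assumes x0: "x \<noteq> 0" and p: "prime_elem p" "p dvd x" and q: "prime_elem q" "q dvd x"
    and pq: "\<not> associates p q"
  shows "\<exists>b c r s. x = b * c \<and> p dvd b \<and> q dvd c \<and> r * b + s * c = 1"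
proof -
  obtain A where A: "\<forall>p\<in>#A. prime_elem p" "associates (prod_mset A) x"
    using pid_prime_factorization_exists[OF x0] by blast
  let ?B = "filter_mset (associates p) A" and ?C = "filter_mset (\<lambda>y. \<not> associates p y) A"
  obtain u where u: "x = prod_mset A * u" using A(2) by (auto simp: associates_def)
  have "x * u dvd x"
    using A(2) u mult_dvd_mono[of x "prod_mset A" u u] by (auto simp: associates_def)
  then have u1: "u dvd 1" using dvd_mult_self_imp_unit x0 by blast
  define b where "b = prod_mset ?B"
  \<comment> \<open>The unit by which the product of \<open>A\<close> differs from \<open>x\<close> is put into the second factor.\<close>
  define c where "c = prod_mset ?C * u"
  have "prod_mset A = prod_mset ?B * prod_mset ?C"
    by (metis multiset_partition prod_mset_Un)
  then have xbc: "x = b * c" unfolding u b_def c_def by (simp add: mult.assoc)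
  then have b0: "b \<noteq> 0" using x0 by auto
  have prime_dvd_b: "associates p e" if e: "prime_elem e" "e dvd b" for e
  proof -
    obtain y where y: "y \<in># ?B" "e dvd y"
      using prime_elem_dvd_prod_mset_idom[OF e(1)] e(2) unfolding b_def by blast
    then have "associates e y" using associates_primeI e(1) A(1) by auto
    moreover have "associates p y" using y(1) by simp
    ultimately show ?thesis by (blast intro: associates_sym associates_trans)
  qed
  have prime_dvd_c: "\<not> associates p e" if e: "prime_elem e" "e dvd c" for e
  proof
    assume pe: "associates p e"
    have "e dvd prod_mset ?C"
      using associates_mult_unit[OF u1, of "prod_mset ?C"] e(2) dvd_trans
      unfolding c_def associates_def by blast
    then obtain y where y: "y \<in># ?C" "e dvd y"
      using prime_elem_dvd_prod_mset_idom[OF e(1)] by blast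
    then have "associates e y" using associates_primeI e(1) A(1) by auto
    then show False using pe y(1) associates_trans by auto
  qed
  have "p dvd b" "q dvd c"
    using p q pq xbc prime_dvd_b prime_dvd_c associates_refl prime_elem_dvd_multD by blast+
  moreover have "\<exists>r s. r * b + s * c = 1"
    using b0 prime_dvd_b prime_dvd_c by (blast intro: pid_comaximalI)
  ultimately show ?thesis using xbc by blast
qed

section \<open>Power series: units and primes\<close>

lemma fps_unit_iff:
  fixes f :: "'a::idom fps"
  shows "f dvd 1 \<longleftrightarrow> fps_nth f 0 dvd 1"
proof
  assume "f dvd 1"
  then obtain g where "1 = f * g" by (rule dvdE)
  then have "fps_nth (f * g) 0 = 1" by (metis fps_one_nth)
  then show "fps_nth f 0 dvd 1" by (metis fps_mult_nth_0 dvdI)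
next
  assume "fps_nth f 0 dvd 1"
  then obtain y where "1 = fps_nth f 0 * y" by (rule dvdE)
  then have "f * fps_right_inverse f y = 1" by (intro fps_right_inverse) simp
  then show "f dvd 1" by (metis dvdI)
qed

lemma fps_nth_0_dvd:
  fixes f g :: "'a::idom fps"
  shows "f dvd g \<Longrightarrow> fps_nth f 0 dvd fps_nth g 0"
  by (auto simp: dvd_def)

lemma fps_eq_const_plus_X_mult:
  fixes f :: "'a::idom fps"
  shows "f = fps_const (fps_nth f 0) + fps_X * fps_shift 1 f"
  by (rule fps_ext) auto

lemma fps_dvd_X_mult_cancel:
  fixes g :: "'a::idom fps"
  assumes "fps_nth g 0 \<noteq> 0" "g dvd fps_X ^ k * b"
  shows "g dvd b"
  using assms(2)
proof (induction k)
  case 0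
  then show ?case by simp
next
  case (Suc k)
  obtain h where h: "fps_X * (fps_X ^ k * b) = g * h"
    using Suc.prems by (auto simp: mult.assoc elim: dvdE)
  then have "fps_nth (g * h) 0 = 0" by (metis fps_X_mult_nth)
  then have "fps_nth h 0 = 0" using assms(1) by simp
  then have "h = fps_X * fps_shift 1 h" using fps_eq_const_plus_X_mult[of h] by simp
  then have "fps_X * (fps_X ^ k * b) = fps_X * (g * fps_shift 1 h)"
    using h by (metis mult.left_commute)
  then have "fps_X ^ k * b = g * fps_shift 1 h" by simp
  then show ?case using Suc.IH by simp
qed

text \<open>
  The constant coefficients of \<open>J\<close> form an ideal of \<open>R\<close>, generated by \<open>d\<^sub>0\<close> for some \<open>d \<in> J\<close>. For
  \<open>x \<in> J\<close> a suitable multiple \<open>c d\<close> with \<open>c \<in> R\<close> has the constant coefficient of \<open>x\<close>, so that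
  \<open>x = c d + X y\<close>, and saturation puts \<open>y\<close> into \<open>J\<close> again. Iterating this step produces the
  coefficients of a series \<open>h\<close> with \<open>x = h d\<close>.
\<close>

lemma X_saturated_ideal_principal:
  fixes J :: "'a::pid fps set"
  assumes J: "ring_ideal J" and sat: "\<And>x. fps_X * x \<in> J \<Longrightarrow> x \<in> J"
  shows "\<exists>d\<in>J. \<forall>x\<in>J. d dvd x"
proof -
  have J0: "0 \<in> J" and Jadd: "\<And>x y. x \<in> J \<Longrightarrow> y \<in> J \<Longrightarrow> x + y \<in> J"
    and Jmult: "\<And>r x. x \<in> J \<Longrightarrow> r * x \<in> J"
    using J by (auto simp: ring_ideal_def)
  let ?I = "(\<lambda>f. fps_nth f 0) ` J"
  have "ring_ideal ?I"
    unfolding ring_ideal_def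
  proof (intro conjI ballI allI)
    show "0 \<in> ?I" using J0 by force
  next
    fix x y assume "x \<in> ?I" "y \<in> ?I"
    then show "x + y \<in> ?I" using Jadd by (metis (no_types, lifting) fps_add_nth image_iff)
  next
    fix r x assume "x \<in> ?I"
    then obtain f where "f \<in> J" "x = fps_nth f 0" by blast
    then have "r * x = fps_nth (fps_const r * f) 0" "fps_const r * f \<in> J" using Jmult by auto
    then show "r * x \<in> ?I" by blast
  qed
  then obtain d0 where d0: "?I = {r * d0 | r. True}" using ideal_principal by blast
  have "d0 = 1 * d0" by simp
  then have "d0 \<in> ?I" unfolding d0 by blast
  then obtain d where d: "d \<in> J" "d0 = fps_nth d 0" by blast
  have step: "\<exists>c y. y \<in> J \<and> x = fps_const c * d + fps_X * y" if x: "x \<in> J" for x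
  proof -
    have "fps_nth x 0 \<in> ?I" using x by blast
    then obtain c where c: "fps_nth x 0 = c * fps_nth d 0" unfolding d0 d(2) by blast
    define w where "w = x + fps_const (- c) * d"
    have "w \<in> J" unfolding w_def using x d(1) Jadd Jmult by blast
    moreover have w: "w = fps_X * fps_shift 1 w"
      using fps_eq_const_plus_X_mult[of w] c by (simp add: w_def)
    ultimately have "fps_shift 1 w \<in> J" using sat by metis
    moreover have "x = fps_const c * d + w"
      by (simp add: w_def flip: fps_const_neg)
    ultimately show ?thesis using w by metis
  qed
  then obtain c y where y: "\<And>x. x \<in> J \<Longrightarrow> y x \<in> J"
    and cy: "\<And>x. x \<in> J \<Longrightarrow> x = fps_const (c x) * d + fps_X * y x"
    by metis
  define h where "h x = Abs_fps (\<lambda>n. c ((y ^^ n) x))" for x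
  have h: "h x = fps_const (c x) + fps_X * h (y x)" for x
  proof (rule fps_ext)
    fix n show "fps_nth (h x) n = fps_nth (fps_const (c x) + fps_X * h (y x)) n"
      by (cases n) (simp_all add: h_def funpow_swap1)
  qed
  have "fps_nth (x - h x * d) n = 0" if "x \<in> J" for x n
    using that
  proof (induction n arbitrary: x)
    case (0 x)
    have "x - h x * d = fps_X * (y x - h (y x) * d)"
      using cy[OF 0] h[of x] by (simp add: algebra_simps)
    then show ?case by (metis fps_X_mult_nth)
  next
    case (Suc n x)
    have "x - h x * d = fps_X * (y x - h (y x) * d)"
      using cy[OF Suc.prems] h[of x] by (simp add: algebra_simps)
    then show ?case using Suc.IH[OF y[OF Suc.prems]] by simp
  qed
  then have "x = h x * d" if "x \<in> J" for x
    using that by (metis eq_iff_diff_eq_0 fps_ext fps_zero_nth)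
  then show ?thesis using d(1) by (metis dvd_triv_right)
qed

text \<open>
  Let \<open>d\<close> generate the saturation of \<open>(g, a)\<close>. As \<open>g\<close> is irreducible, either \<open>g\<close> divides \<open>d\<close> and
  hence \<open>a\<close>, or \<open>d\<close> is a unit. In the second case some \<open>X\<^sup>k\<close> lies in \<open>(g, a)\<close>, so \<open>g\<close> divides
  \<open>X\<^sup>k b\<close> and hence \<open>b\<close>.
\<close>

lemma irreducible_fps_imp_prime_elem:
  fixes g :: "'a::pid fps"
  assumes g: "irreducible g" and g0: "fps_nth g 0 \<noteq> 0"
  shows "prime_elem g"
proof (rule prime_elemI)
  show "g \<noteq> 0" "\<not> g dvd 1" using g by (auto simp: irreducible_def)
next
  fix a b assume ab: "g dvd a * b"
  let ?J = "{x. \<exists>k u v. fps_X ^ k * x = u * g + v * a}"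
  have "ring_ideal ?J"
    unfolding ring_ideal_def
  proof (intro conjI ballI allI)
    show "0 \<in> ?J" by (auto intro!: exI[of _ 0])
  next
    fix x y assume "x \<in> ?J" "y \<in> ?J"
    then obtain k u v k' u' v' where
      x: "fps_X ^ k * x = u * g + v * a" and y: "fps_X ^ k' * y = u' * g + v' * a" by blast
    have "fps_X ^ (k + k') * (x + y) = fps_X ^ k' * (fps_X ^ k * x) + fps_X ^ k * (fps_X ^ k' * y)"
      by (simp add: power_add algebra_simps)
    also have "\<dots> = (fps_X ^ k' * u + fps_X ^ k * u') * g + (fps_X ^ k' * v + fps_X ^ k * v') * a"
      unfolding x y by (simp add: algebra_simps)
    finally show "x + y \<in> ?J" by blast
  next
    fix r x assume "x \<in> ?J"
    then obtain k u v where x: "fps_X ^ k * x = u * g + v * a" by blast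
    have "fps_X ^ k * (r * x) = (r * u) * g + (r * v) * a"
      unfolding mult.left_commute[of "fps_X ^ k"] x by (simp add: algebra_simps)
    then show "r * x \<in> ?J" by blast
  qed
  moreover have "x \<in> ?J" if X: "fps_X * x \<in> ?J" for x
  proof -
    obtain k u v where "fps_X ^ k * (fps_X * x) = u * g + v * a" using X by blast
    then have "fps_X ^ Suc k * x = u * g + v * a" by (simp add: ac_simps)
    then show ?thesis by blast
  qed
  ultimately obtain d where d: "d \<in> ?J" "\<forall>x\<in>?J. d dvd x"
    using X_saturated_ideal_principal[of ?J] by blast
  have "fps_X ^ 0 * g = 1 * g + 0 * a" "fps_X ^ 0 * a = 0 * g + 1 * a" by simp_all
  then have "g \<in> ?J" "a \<in> ?J" by blast+
  then have dg: "d dvd g" and da: "d dvd a" using d(2) by blast+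
  obtain e where e: "g = d * e" using dg by (rule dvdE)
  have "d dvd 1 \<or> e dvd 1" using g e by (rule irreducibleD)
  then show "g dvd a \<or> g dvd b"
  proof
    assume "e dvd 1"
    then have "g dvd d" using associates_mult_unit[of e d] e by (simp add: associates_def)
    then show ?thesis using da dvd_trans by blast
  next
    assume d1: "d dvd 1"
    obtain k u v where k: "fps_X ^ k * d = u * g + v * a" using d(1) by blast
    have "fps_X ^ k * (b * d) = b * (fps_X ^ k * d)" by (simp add: ac_simps)
    also have "\<dots> = g * (u * b) + v * (a * b)" unfolding k by (simp add: algebra_simps)
    finally have "g dvd fps_X ^ k * (b * d)" using ab by simp
    then have "g dvd b * d" by (rule fps_dvd_X_mult_cancel[OF g0])
    then have "g dvd b"
      using associates_mult_unit[OF d1, of b] dvd_trans unfolding associates_def by blast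
    then show ?thesis ..
  qed
qed

lemma fps_prime_factorization_exists:
  fixes f :: "'a::pid fps"
  assumes "fps_nth f 0 \<noteq> 0"
  shows "\<exists>A. (\<forall>p\<in>#A. prime_elem p) \<and> associates (prod_mset A) f"
proof -
  let ?r = "inv_image {(a, b :: 'a). a dvd b \<and> \<not> b dvd a} (\<lambda>f. fps_nth f 0)"
  have "\<exists>A. (\<forall>p\<in>#A. irreducible p) \<and> associates (prod_mset A) f"
  proof (rule irreducible_factorization_exists[OF wf_inv_image[OF wf_proper_dvd]])
    show "f \<in> {f. fps_nth f 0 \<noteq> 0}" using assms by simp
  next
    fix a b :: "'a fps" assume "a * b \<in> {f. fps_nth f 0 \<noteq> 0}" "\<not> b dvd 1"
    then show "a \<in> {f. fps_nth f 0 \<noteq> 0} \<and> (a, a * b) \<in> ?r"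
      using dvd_mult_self_imp_unit[of "fps_nth a 0" "fps_nth b 0"] by (auto simp: fps_unit_iff)
  qed simp
  then obtain A where A: "\<forall>p\<in>#A. irreducible p" "associates (prod_mset A) f" by blast
  have "prime_elem p" if p: "p \<in># A" for p
  proof (rule irreducible_fps_imp_prime_elem)
    show "irreducible p" using A(1) p by blast
    have "p dvd f" using dvd_prod_mset[OF p] A(2) dvd_trans unfolding associates_def by blast
    then show "fps_nth p 0 \<noteq> 0" using fps_nth_0_dvd[of p f] assms by auto
  qed
  then show ?thesis using A(2) by blast
qed

section \<open>Lifting factorizations of the constant coefficient\<close>

fun quadratic_root_coeff :: "'a::comm_ring_1 \<Rightarrow> (nat \<Rightarrow> 'a) \<Rightarrow> nat \<Rightarrow> 'a" where
  "quadratic_root_coeff k F n =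
     F n - k * (\<Sum>i\<in>{1..<n}. quadratic_root_coeff k F i * quadratic_root_coeff k F (n - i))"

declare quadratic_root_coeff.simps [simp del]

text \<open>
  The equation determines the coefficients of \<open>T\<close> one after the other: as \<open>T\<^sub>0 = 0\<close>, the coefficient
  of \<open>X\<^sup>n\<close> in \<open>T\<^sup>2\<close> involves only the coefficients \<open>T\<^sub>i\<close> with \<open>0 < i < n\<close>.
\<close>

lemma fps_quadratic_root_exists:
  fixes F :: "'a::idom fps"
  assumes F0: "fps_nth F 0 = 0"
  shows "\<exists>T. fps_nth T 0 = 0 \<and> T + fps_const k * T ^ 2 = F"
proof -
  define T where "T = Abs_fps (quadratic_root_coeff k (fps_nth F))"
  have T0: "fps_nth T 0 = 0"
    unfolding T_def fps_nth_Abs_fps by (subst quadratic_root_coeff.simps) (simp add: F0)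
  have "fps_nth (T + fps_const k * T ^ 2) n = fps_nth F n" for n
  proof -
    have "fps_nth (T ^ 2) n = (\<Sum>i=0..n. fps_nth T i * fps_nth T (n - i))"
      by (simp add: power2_eq_square fps_mult_nth)
    also have "\<dots> = (\<Sum>i\<in>{1..<n}. fps_nth T i * fps_nth T (n - i))"
    proof (rule sum.mono_neutral_right)
      show "\<forall>i\<in>{0..n} - {1..<n}. fps_nth T i * fps_nth T (n - i) = 0"
      proof
        fix i assume "i \<in> {0..n} - {1..<n}"
        then have "i = 0 \<or> i = n" by auto
        then show "fps_nth T i * fps_nth T (n - i) = 0" using T0 by auto
      qed
    qed auto
    finally have "fps_nth (T ^ 2) n = (\<Sum>i\<in>{1..<n}. fps_nth T i * fps_nth T (n - i))" .
    moreover have "fps_nth T n = fps_nth F n - k * (\<Sum>i\<in>{1..<n}. fps_nth T i * fps_nth T (n - i))"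
      unfolding T_def fps_nth_Abs_fps by (rule quadratic_root_coeff.simps)
    ultimately show ?thesis by simp
  qed
  then have "T + fps_const k * T ^ 2 = F" by (intro fps_ext)
  then show ?thesis using T0 by blast
qed

text \<open>
  With the ansatz \<open>g = b + s T\<close> and \<open>h = c + r T\<close> the relation \<open>r b + s c = 1\<close> gives
  \<open>g h = b c + T + r s T\<^sup>2\<close>. Since \<open>T\<close> has coefficient \<open>1\<close> here, \<open>g h = f\<close> is solvable for \<open>T\<close>.
\<close>

lemma lift_comaximal_factorization:
  fixes f :: "'a::idom fps"
  assumes f0: "fps_nth f 0 = b * c" and rs: "r * b + s * c = 1"
  shows "\<exists>g h. f = g * h \<and> fps_nth g 0 = b \<and> fps_nth h 0 = c"
proof -
  obtain T where T0: "fps_nth T 0 = 0"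
    and T: "T + fps_const (r * s) * T ^ 2 = f - fps_const (b * c)"
    using fps_quadratic_root_exists[of "f - fps_const (b * c)" "r * s"] f0 by auto
  let ?g = "fps_const b + fps_const s * T" and ?h = "fps_const c + fps_const r * T"
  have "?g * ?h = fps_const (b * c) + fps_const (r * b + s * c) * T + fps_const (r * s) * T ^ 2"
    by (simp add: algebra_simps power2_eq_square flip: fps_const_mult fps_const_add)
  also have "\<dots> = fps_const (b * c) + (T + fps_const (r * s) * T ^ 2)"
    unfolding rs by (simp add: add.assoc)
  also have "\<dots> = f" unfolding T by simp
  finally have "f = ?g * ?h" by simp
  moreover have "fps_nth ?g 0 = b" "fps_nth ?h 0 = c" using T0 by simp_all
  ultimately show ?thesis by blast
qed

text \<open>
  Nonassociate primes \<open>p\<close> and \<open>q\<close> dividing \<open>g\<^sub>0\<close> would split it into two comaximal nonunits, and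
  lifting this splitting would factor \<open>g\<close>.
\<close>

lemma irreducible_fps_primes_associate:
  fixes g :: "'a::pid fps"
  assumes g: "irreducible g" and g0: "fps_nth g 0 \<noteq> 0"
    and p: "prime_elem p" "p dvd fps_nth g 0" and q: "prime_elem q" "q dvd fps_nth g 0"
  shows "associates p q"
proof (rule ccontr)
  assume "\<not> associates p q"
  then obtain b c r s where bc: "fps_nth g 0 = b * c" "p dvd b" "q dvd c" "r * b + s * c = 1"
    using comaximal_factorization_exists[OF g0 p q] by blast
  obtain h k where hk: "g = h * k" "fps_nth h 0 = b" "fps_nth k 0 = c"
    using lift_comaximal_factorization[OF bc(1,4)] by blast
  have "h dvd 1 \<or> k dvd 1" using g hk(1) by (rule irreducibleD)
  then have "b dvd 1 \<or> c dvd 1" using hk fps_unit_iff by blast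
  then have "p dvd 1 \<or> q dvd 1" using bc(2,3) dvd_trans by blast
  then show False using p(1) q(1) by (auto simp: prime_elem_def)
qed

section \<open>Counting factors\<close>

lemma prime_factorization_of_constant_coeff:
  fixes A :: "'a::pid fps multiset"
  assumes "\<forall>g\<in>#A. fps_nth g 0 \<noteq> 0 \<and> \<not> g dvd 1"
  shows "\<exists>B. (\<forall>p\<in>#B. prime_elem p) \<and> associates (prod_mset B) (fps_nth (prod_mset A) 0) \<and>
             size A \<le> size B"
  using assms
proof (induction A)
  case empty
  show ?case by (rule exI[of _ "{#}"]) (simp add: associates_refl)
next
  case (add g A)
  then obtain B where B: "\<forall>p\<in>#B. prime_elem p" "size A \<le> size B"
      "associates (prod_mset B) (fps_nth (prod_mset A) 0)" by auto
  obtain C where C: "\<forall>p\<in>#C. prime_elem p" "associates (prod_mset C) (fps_nth g 0)"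
    using pid_prime_factorization_exists[of "fps_nth g 0"] add.prems by auto
  have "C \<noteq> {#}" using C(2) add.prems by (auto simp: associates_def fps_unit_iff)
  then have "size C \<ge> 1" by (simp add: Suc_le_eq nonempty_has_size)
  then have "size (add_mset g A) \<le> size (C + B)" using B(2) by simp
  moreover have "associates (prod_mset (C + B)) (fps_nth (prod_mset (add_mset g A)) 0)"
    using associates_mult[OF C(2) B(3)] by simp
  ultimately show ?case using B(1) C(1) by (metis union_iff)
qed

lemma size_le_Omega_constant_coeff:
  fixes f :: "'a::pid fps"
  assumes f0: "fps_nth f 0 \<noteq> 0"
    and A: "\<forall>g\<in>#A. prime_elem g" "associates (prod_mset A) f"
  shows "size A \<le> Omega (fps_nth f 0)"
proof -
  have A0: "fps_nth (prod_mset A) 0 \<noteq> 0"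
    using A(2) f0 fps_nth_0_dvd[of "prod_mset A" f] by (auto simp: associates_def)
  have "fps_nth g 0 \<noteq> 0 \<and> \<not> g dvd 1" if "g \<in># A" for g
    using that A(1) A0 fps_nth_0_dvd[OF dvd_prod_mset[OF that]] by (auto simp: prime_elem_def)
  then obtain B where B: "\<forall>p\<in>#B. prime_elem p" "size A \<le> size B"
      "associates (prod_mset B) (fps_nth (prod_mset A) 0)"
    using prime_factorization_of_constant_coeff[of A] by blast
  have "associates (fps_nth (prod_mset A) 0) (fps_nth f 0)"
    using A(2) fps_nth_0_dvd unfolding associates_def by blast
  then have "Omega (fps_nth f 0) = size B"
    using B(1,3) by (blast intro: Omega_eqI associates_trans)
  then show ?thesis using B(2) by simp
qed

text \<open>
  The primes dividing \<open>g\<^sub>0\<close> for a prime factor \<open>g\<close> of \<open>f\<close> form a single class \<open>K g\<close>, and every class of primes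
  dividing \<open>f\<^sub>0\<close> is \<open>K g\<close> for some \<open>g\<close>.
\<close>

lemma omega_constant_coeff_le_size:
  fixes f :: "'a::pid fps"
  assumes f0: "fps_nth f 0 \<noteq> 0"
    and A: "\<forall>g\<in>#A. prime_elem g" "associates (prod_mset A) f"
  shows "omega (fps_nth f 0) \<le> size A"
proof -
  let ?P = "{p. prime_elem p \<and> p dvd fps_nth f 0} // {(p, q). associates p q}"
  define K where
    "K g = {q. \<exists>p. prime_elem p \<and> p dvd fps_nth g 0 \<and> associates p q}" for g :: "'a fps"
  have "?P \<subseteq> K ` set_mset A"
  proof
    fix Q assume "Q \<in> ?P"
    then obtain p where p: "prime_elem p" "p dvd fps_nth f 0" and Q: "Q = {q. associates p q}"
      by (auto simp: quotient_def)
    have "fps_nth f 0 dvd fps_nth (prod_mset A) 0"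
      using A(2) fps_nth_0_dvd by (auto simp: associates_def)
    then have "p dvd fps_nth (prod_mset A) 0" using p(2) dvd_trans by blast
    moreover have "fps_nth (prod_mset A) 0 = prod_mset (image_mset (\<lambda>g. fps_nth g 0) A)"
      by (induction A) simp_all
    ultimately obtain g where g: "g \<in># A" "p dvd fps_nth g 0"
      using prime_elem_dvd_prod_mset_idom[OF p(1)] by fastforce
    have "g dvd f" using dvd_prod_mset[OF g(1)] A(2) dvd_trans unfolding associates_def by blast
    then have "fps_nth g 0 \<noteq> 0" using fps_nth_0_dvd[of g f] f0 by auto
    moreover have "irreducible g" using A(1) g(1) prime_elem_imp_irreducible_idom by blast
    ultimately have same: "associates p p'" if "prime_elem p'" "p' dvd fps_nth g 0" for p'
      using irreducible_fps_primes_associate p(1) g(2) that by blast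
    have "K g = Q"
      unfolding K_def Q using p(1) g(2) same associates_trans by blast
    then show "Q \<in> K ` set_mset A" using g(1) by blast
  qed
  then have "card ?P \<le> card (K ` set_mset A)" by (intro card_mono) auto
  also have "\<dots> \<le> card (set_mset A)" by (rule card_image_le) simp
  also have "\<dots> \<le> size A" by (induction A) (simp_all add: card_insert_if)
  finally show ?thesis by (simp add: omega_def)
qed

lemma irreducible_fpsI_prime_constant_coeff:
  fixes f :: "'a::idom fps"
  assumes "prime_elem (fps_nth f 0)"
  shows "irreducible f"
proof (rule irreducibleI)
  show "f \<noteq> 0" "\<not> f dvd 1" using assms by (auto simp: prime_elem_def fps_unit_iff)
next
  fix g h assume "f = g * h"
  then have "fps_nth f 0 = fps_nth g 0 * fps_nth h 0" by simp
  then show "g dvd 1 \<or> h dvd 1"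
    using irreducibleD[OF prime_elem_imp_irreducible_idom[OF assms]] by (simp add: fps_unit_iff)
qed

theorem theorem1:
  fixes f :: "'a::pid fps" and a\<^sub>0 :: 'a
  assumes "fps_nth f 0 = a\<^sub>0"
    and "a\<^sub>0 \<noteq> 0" and "\<not> a\<^sub>0 dvd 1"
  shows "omega a\<^sub>0 \<le> irreducible_count f \<and> irreducible_count f \<le> Omega a\<^sub>0 \<and>
         ((\<exists>p. prime_elem p \<and> associates a\<^sub>0 p) \<longrightarrow> irreducible f)"
proof -
  have f0: "fps_nth f 0 \<noteq> 0" using assms by simp
  obtain A where A: "\<forall>g\<in>#A. prime_elem g" "associates (prod_mset A) f"
    using fps_prime_factorization_exists[OF f0] by blast
  have "irreducible_count f = size A" using A by (rule irreducible_count_eqI)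
  moreover have "irreducible f" if "prime_elem p" "associates a\<^sub>0 p" for p
    using prime_elem_associates[OF that(1) associates_sym[OF that(2)]] assms(1)
    by (blast intro: irreducible_fpsI_prime_constant_coeff)
  ultimately show ?thesis
    using omega_constant_coeff_le_size[OF f0 A] size_le_Omega_constant_coeff[OF f0 A] assms(1)
    by auto
qed

end
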